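(* Consider $\min_{\mathbf{x}\in\mathbb{R}^n}\max_{\mathbf{y}\in\mathbb{R}^m}F(\mathbf{x})+H(\mathbf{x},\mathbf{y})-G(\mathbf{y})$ with $H(\mathbf{x},\mathbf{y})=\mathbf{x}^\top\mathbf{B}\mathbf{y}-\mathbf{x}^\top\mathbf{u}_{\mathbf{x}}+\mathbf{u}_{\mathbf{y}}^\top\mathbf{y}$, where $F$ is $L_F$-smooth and $\mu_F$-strongly convex, $G$ is $L_G$-smooth and $\mu_G$-strongly convex ($\mu_F,\mu_G>0$), with unique saddle point $(\boldsymbol{\omega}_{\mathbf{x}}^\star,\boldsymbol{\omega}_{\mathbf{y}}^\star)$. Set $$L_{\mathrm{Str}}=L_F\vee\left(\tfrac{\mu_F}{\mu_G}L_G\right),\quad L_{\mathrm{Bil}}=\sqrt{\lambda_{\max}(\mathbf{B}^\top\mathbf{B})\cdot\tfrac{\mu_F}{\mu_G}},\quad \mu_{\mathrm{Str}}=\mu_F,\quad \mathcal{R}=\tfrac{\mu_G}{\mu_F}.$$ Then for every $\mathscr{T}\ge1$, the single-epoch deterministic AG-EG algorithm (see context) with $\alpha_t=\frac{2}{t+1}$ and $\eta_t=\frac{t}{2L_{\mathrm{Str}}+L_{\mathrm{Bil}}t}$ satisfies $$\|\mathbf{x}^{\mathrm{ag}}_{\mathscr{T}-\frac12}-\boldsymbol{\omega}_{\mathbf{x}}^\star\|^2+\mathcal{R}\|\mathbf{y}^{\mathrm{ag}}_{\mathscr{T}-\frac12}-\boldsymbol{\omega}_{\mathbf{y}}^\s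tar\|^2\le\frac{2}{\mu_{\mathrm{Str}}(\mathscr{T}+1)}\left(\frac{2L_{\mathrm{Str}}}{\mathscr{T}}+L_{\mathrm{Bil}}\right)\left[\|\mathbf{x}_0-\boldsymbol{\omega}_{\mathbf{x}}^\star\|^2+\mathcal{R}\|\mathbf{y}_0-\boldsymbol{\omega}_{\mathbf{y}}^\star\|^2\right].$$
   Context: Norms are Euclidean; $a\vee b=\max(a,b)$; $\lambda_{\max}$ is the largest eigenvalue; $\mathbf{B}\in\mathbb{R}^{n\times m}$ with $n\ge m$ (without loss of generality). "$L$-smooth and $\mu$-strongly convex" means $\frac{\mu}{2}\|\mathbf{x}-\mathbf{x}'\|^2\le F(\mathbf{x})-F(\mathbf{x}')-\nabla F(\mathbf{x}')^\top(\mathbf{x}-\mathbf{x}')\le\frac{L}{2}\|\mathbf{x}-\mathbf{x}'\|^2$ for all $\mathbf{x},\mathbf{x}'$. A saddle point satisfies $\mathscr{F}(\boldsymbol{\omega}_{\mathbf{x}}^\star,\mathbf{y})\le\mathscr{F}(\boldsymbol{\omega}_{\mathbf{x}}^\star,\boldsymbol{\omega}_{\mathbf{y}}^\star)\le\mathscr{F}(\mathbf{x},\boldsymbol{\omega}_{\mathbf{y}}^\star)$ for all $\mathbf{x},\mathbf{y}$, where $\mathscr{F}=F+H-G$. Single-epoch deterministic AG-EG algorithm: from $[\mathbf{x}_0;\mathbf{y}_0]\in\mathbb{R}^{n+m}$ set $\mathbf{x}^{\mathrm{ag}}_{-1/2}=\mathbf{x}^{\mathrm{md}}_0=\mathbf{x}_0$,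 $\mathbf{y}^{\mathrm{ag}}_{-1/2}=\mathbf{y}^{\mathrm{md}}_0=\mathbf{y}_0$. For $t=1,\dots,\mathscr{T}$ set $\mathbf{x}_{t-\frac12}=\mathbf{x}_{t-1}-\eta_t(\nabla F(\mathbf{x}^{\mathrm{md}}_{t-1})+\nabla_{\mathbf{x}}H(\mathbf{x}_{t-1},\mathbf{y}_{t-1}))$, $\mathbf{y}_{t-\frac12}=\mathbf{y}_{t-1}-\frac{\eta_t}{\mathcal{R}}(-\nabla_{\mathbf{y}}H(\mathbf{x}_{t-1},\mathbf{y}_{t-1})+\nabla G(\mathbf{y}^{\mathrm{md}}_{t-1}))$, $\mathbf{x}^{\mathrm{ag}}_{t-\frac12}=(1-\alpha_t)\mathbf{x}^{\mathrm{ag}}_{t-\frac32}+\alpha_t\mathbf{x}_{t-\frac12}$, $\ \mathbf{y}^{\mathrm{ag}}_{t-\frac12}=(1-\alpha_t)\mathbf{y}^{\mathrm{ag}}_{t-\frac32}+\alpha_t\mathbf{y}_{t-\frac12}$, $\mathbf{x}_t=\mathbf{x}_{t-1}-\eta_t(\nabla F(\mathbf{x}^{\mathrm{md}}_{t-1})+\nabla_{\mathbf{x}}H(\mathbf{x}_{t-\frac12},\mathbf{y}_{t-\frac12}))$, $\mathbf{y}_t=\mathbf{y}_{t-1}-\frac{\eta_t}{\mathcal{R}}(-\nabla_{\mathbf{y}}H(\mathbf{x}_{t-\frac12},\mathbf{y}_{t-\frac12})+\nabla G(\mathbf{y}^{\mathrm{md}}_{t-1}))$, $\mathbf{x}^{\mathrm{md}}_t=(1-\alpha_{t+1})\mathbf{x}^{\mathrm{ag}}_{t-\frac12}+\alpha_{t+1}\mathbf{x}_t$,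 $\ \mathbf{y}^{\mathrm{md}}_t=(1-\alpha_{t+1})\mathbf{y}^{\mathrm{ag}}_{t-\frac12}+\alpha_{t+1}\mathbf{y}_t$. *)

theory Defs
  imports "HOL-Analysis.Analysis"
begin

definition grad :: "('a::real_inner \<Rightarrow> real) \<Rightarrow> 'a \<Rightarrow> 'a" where
  "grad f x = (THE D. GDERIV f x :> D)"

definition smooth_strongly_convex ::
    "real \<Rightarrow> real \<Rightarrow> ('a::euclidean_space \<Rightarrow> real) \<Rightarrow> bool" where
  "smooth_strongly_convex L \<mu> f \<longleftrightarrow>
     (\<forall>x. f differentiable (at x)) \<and>
     (\<forall>x x'. \<mu> / 2 * (norm (x - x'))\<^sup>2 \<le> f x - f x' - grad f x' \<bullet> (x - x') \<and>
             f x - f x' - grad f x' \<bullet> (x - x') \<le> L / 2 * (norm (x - x'))\<^sup>2)"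

definition matrix_eigenvalue :: "real ^ 'k ^ 'k \<Rightarrow> real \<Rightarrow> bool" where
  "matrix_eigenvalue A l \<longleftrightarrow> (\<exists>v. v \<noteq> 0 \<and> A *v v = l *\<^sub>R v)"

definition lambda_max :: "real ^ 'k ^ 'k \<Rightarrow> real" where
  "lambda_max A = (GREATEST l. matrix_eigenvalue A l)"

definition saddle_point :: "('a \<Rightarrow> 'b \<Rightarrow> real) \<Rightarrow> 'a \<Rightarrow> 'b \<Rightarrow> bool" where
  "saddle_point \<Phi> wx wy \<longleftrightarrow> (\<forall>x y. \<Phi> wx y \<le> \<Phi> wx wy \<and> \<Phi> wx wy \<le> \<Phi> x wy)"

definition bilinear_coupling ::
    "real ^ 'm ^ 'n \<Rightarrow> real ^ 'n \<Rightarrow> real ^ 'm \<Rightarrow> real ^ 'n \<Rightarrow> real ^ 'm \<Rightarrow> real" where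
  "bilinear_coupling B ux uy x y = x \<bullet> (B *v y) - x \<bullet> ux + uy \<bullet> y"

text \<open>
  \<open>ag_eg_run F G H R \<alpha> \<eta> T x0 y0 x xh xag xmd y yh yag ymd\<close> says that the given
  sequences are the iterates of \<open>T\<close> steps of the method started at \<open>(x0, y0)\<close>.
  Half-integer indices are shifted up by one half: \<open>xh t\<close> and \<open>xag t\<close> stand for the
  vectors with index \<open>t - 1/2\<close>, so \<open>xag 0\<close> is the one with index \<open>- 1/2\<close>;
  \<open>xh 0\<close> and \<open>yh 0\<close> are not part of the method.
\<close>

definition ag_eg_run ::
    "('a::euclidean_space \<Rightarrow> real) \<Rightarrow> ('b::euclidean_space \<Rightarrow> real) \<Rightarrow> ('a \<Rightarrow> 'b \<Rightarrow> real) \<Rightarrow>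
     real \<Rightarrow> (nat \<Rightarrow> real) \<Rightarrow> (nat \<Rightarrow> real) \<Rightarrow> nat \<Rightarrow> 'a \<Rightarrow> 'b \<Rightarrow>
     (nat \<Rightarrow> 'a) \<Rightarrow> (nat \<Rightarrow> 'a) \<Rightarrow> (nat \<Rightarrow> 'a) \<Rightarrow> (nat \<Rightarrow> 'a) \<Rightarrow>
     (nat \<Rightarrow> 'b) \<Rightarrow> (nat \<Rightarrow> 'b) \<Rightarrow> (nat \<Rightarrow> 'b) \<Rightarrow> (nat \<Rightarrow> 'b) \<Rightarrow> bool" where
  "ag_eg_run F G H R \<alpha> \<eta> T x0 y0 x xh xag xmd y yh yag ymd \<longleftrightarrow>
     x 0 = x0 \<and> xag 0 = x0 \<and> xmd 0 = x0 \<and>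
     y 0 = y0 \<and> yag 0 = y0 \<and> ymd 0 = y0 \<and>
     (\<forall>t\<in>{1..T}.
        xh t = x (t - 1) - \<eta> t *\<^sub>R
                 (grad F (xmd (t - 1)) + grad (\<lambda>u. H u (y (t - 1))) (x (t - 1))) \<and>
        yh t = y (t - 1) - (\<eta> t / R) *\<^sub>R
                 (- grad (\<lambda>v. H (x (t - 1)) v) (y (t - 1)) + grad G (ymd (t - 1))) \<and>
        xag t = (1 - \<alpha> t) *\<^sub>R xag (t - 1) + \<alpha> t *\<^sub>R xh t \<and>
        yag t = (1 - \<alpha> t) *\<^sub>R yag (t - 1) + \<alpha> t *\<^sub>R yh t \<and>
        x t = x (t - 1) - \<eta> t *\<^sub>R
                (grad F (xmd (t - 1)) + grad (\<lambda>u. H u (yh t)) (xh t)) \<and>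
        y t = y (t - 1) - (\<eta> t / R) *\<^sub>R
                (- grad (\<lambda>v. H (xh t) v) (yh t) + grad G (ymd (t - 1))) \<and>
        xmd t = (1 - \<alpha> (t + 1)) *\<^sub>R xag t + \<alpha> (t + 1) *\<^sub>R x t \<and>
        ymd t = (1 - \<alpha> (t + 1)) *\<^sub>R yag t + \<alpha> (t + 1) *\<^sub>R y t)"

end

theory Submission
  imports Defs
begin

text \<open>
  In the coordinates \<open>z = (x, sqrt R y)\<close> the method becomes an accelerated extragradient scheme for
  one function \<open>f z = F x + G y\<close>, with the same constants \<open>L_Str\<close> and \<open>\<mu>_Str\<close> in both blocks, and
  one skew affine field \<open>W\<close> with Lipschitz constant \<open>L_Bil\<close>; the saddle point becomes the zero
  \<open>w\<close> of \<open>\<nabla>f + W\<close>. Let \<open>V\<^sub>t\<close> be the Bregman divergence of \<open>f\<close> from \<open>w\<close> to the \<open>t\<close>-th aggregate and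
  \<open>D\<^sub>t = \<parallel>z\<^sub>t - w\<parallel>\<^sup>2\<close>. Acceleration combined with the extragradient identity yields
  \<open>t (t + 1) V\<^sub>t - (t - 1) t V\<^sub>t\<^sub>-\<^sub>1 \<le> (2 L_Str + L_Bil t) (D\<^sub>t\<^sub>-\<^sub>1 - D\<^sub>t)\<close>. The weights on the right grow
  with \<open>t\<close>, so the sum does not telescope; however \<open>V\<^sub>t \<ge> 0\<close> forces \<open>D\<^sub>t \<le> D\<^sub>0\<close> inductively, which
  gives \<open>t (t + 1) V\<^sub>t \<le> (2 L_Str + L_Bil t) D\<^sub>0\<close>. Strong convexity bounds \<open>V\<^sub>t\<close> from below.
\<close>

section \<open>Accelerated extragradient for one function and one skew field\<close>

text \<open>The map \<open>g\<close> is a free parameter in the role of the gradient of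
  \<open>f\<close>. The convergence analysis then uses only the two quadratic bounds and no
  derivatives.\<close>

definition bregman :: "('a::real_inner \<Rightarrow> real) \<Rightarrow> ('a \<Rightarrow> 'a) \<Rightarrow> 'a \<Rightarrow> 'a \<Rightarrow> real" where
  "bregman f g z z' = f z - f z' - g z' \<bullet> (z - z')"

text \<open>Since \<open>e *\<^sub>R (p + q') = z - z'\<close>, this is the four-point identity for
  twice the inner product of \<open>z - z'\<close> and \<open>zh - w\<close>. Both points start from
  \<open>z\<close> with the same \<open>p\<close>, so the remaining distance comes from
  \<open>zh - z' = e *\<^sub>R (q' - q)\<close>.\<close>

lemma extragradient_identity:
  fixes z :: "'a::real_inner"
  assumes zh: "zh = z - e *\<^sub>R (p + q)" and z': "z' = z - e *\<^sub>R (p + q')"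
  shows "2 * e * ((p + q') \<bullet> (zh - w)) =
    (norm (z - w))\<^sup>2 - (norm (z' - w))\<^sup>2 - (norm (zh - z))\<^sup>2 + e\<^sup>2 * (norm (q' - q))\<^sup>2"
  unfolding zh z' power2_norm_eq_inner
  by (simp add: inner_diff inner_add inner_commute algebra_simps power2_eq_square)

lemma accelerated_bregman_step:
  fixes f :: "'a::real_inner \<Rightarrow> real"
  assumes lower: "\<And>z z'. 0 \<le> bregman f g z z'"
    and upper: "\<And>z z'. bregman f g z z' \<le> L / 2 * (norm (z - z'))\<^sup>2"
    and a: "0 \<le> a" "a \<le> 1"
    and md: "md = (1 - a) *\<^sub>R ag + a *\<^sub>R z"
    and ag': "ag' = (1 - a) *\<^sub>R ag + a *\<^sub>R zh"
  shows "bregman f g ag' w - (1 - a) * bregman f g ag w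
    \<le> a * ((g md - g w) \<bullet> (zh - w)) + L / 2 * (a\<^sup>2 * (norm (zh - z))\<^sup>2)"
proof -
  have "ag' - md = a *\<^sub>R (zh - z)"
    by (simp add: md ag' algebra_simps)
  then have "bregman f g ag' md \<le> L / 2 * (a\<^sup>2 * (norm (zh - z))\<^sup>2)"
    using upper[of ag' md] by (simp add: power_mult_distrib)
  moreover have "0 \<le> (1 - a) * bregman f g ag md" "0 \<le> a * bregman f g w md"
    using a lower by simp_all
  moreover have "bregman f g ag' w - (1 - a) * bregman f g ag w =
      a * ((g md - g w) \<bullet> (zh - w))
      + bregman f g ag' md - (1 - a) * bregman f g ag md - a * bregman f g w md"
    by (simp add: bregman_def md ag' inner_diff inner_add algebra_simps)
  ultimately show ?thesis by linarith
qed

text \<open>Under this condition the squared displacement of the half step absorbs both the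
  Lipschitz error of the field and the smoothness error. With \<open>s = e * K\<close> the first
  summand is the square of \<open>s\<close>, at most \<open>s\<close>, and the second is
  \<open>1 - s\<close> times a factor below 1.\<close>

lemma step_size_bound:
  fixes L K :: real and t :: nat
  assumes "L > 0" "K \<ge> 0" "t \<ge> 1"
  defines "a \<equiv> 2 / (real t + 1)" and "e \<equiv> real t / (2 * L + K * real t)"
  shows "e\<^sup>2 * K\<^sup>2 + L * a * e \<le> 1"
proof -
  define s where "s = K * real t / (2 * L + K * real t)"
  have pos: "2 * L + K * real t > 0" using assms by (simp add: add_pos_nonneg)
  have s: "0 \<le> s" "s \<le> 1" and s1: "1 - s = 2 * L / (2 * L + K * real t)"
    using pos assms by (simp_all add: s_def field_simps)
  have "e\<^sup>2 * K\<^sup>2 = s\<^sup>2" by (simp add: e_def s_def power_divide power_mult_distrib)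
  moreover have "s\<^sup>2 \<le> s" using s by (simp add: power2_eq_square mult_left_le)
  moreover have "L * a * e = (1 - s) * (real t / (real t + 1))"
    unfolding s1 a_def e_def by (simp add: mult_ac)
  moreover have "\<dots> \<le> 1 - s" using s by (intro mult_left_le) simp_all
  ultimately show ?thesis by linarith
qed

lemma accelerated_extragradient_bound:
  fixes f :: "'a::real_inner \<Rightarrow> real" and g W :: "'a \<Rightarrow> 'a" and z zh ag md :: "nat \<Rightarrow> 'a"
  assumes L: "L > 0" and K: "K \<ge> 0"
    and lower: "\<And>z z'. 0 \<le> bregman f g z z'"
    and upper: "\<And>z z'. bregman f g z z' \<le> L / 2 * (norm (z - z'))\<^sup>2"
    and skew: "\<And>z z'. (W z - W z') \<bullet> (z - z') = 0"
    and lipschitz: "\<And>z z'. norm (W z - W z') \<le> K * norm (z - z')"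
    and zero: "g w + W w = 0"
    and alpha: "\<And>t. t \<ge> 1 \<Longrightarrow> \<alpha> t = 2 / (real t + 1)"
    and eta: "\<And>t. t \<ge> 1 \<Longrightarrow> \<eta> t = real t / (2 * L + K * real t)"
    and init: "ag 0 = z 0" "md 0 = z 0"
    and zh: "\<And>t. t < T \<Longrightarrow> zh (Suc t) = z t - \<eta> (Suc t) *\<^sub>R (g (md t) + W (z t))"
    and ag: "\<And>t. t < T \<Longrightarrow> ag (Suc t) = (1 - \<alpha> (Suc t)) *\<^sub>R ag t + \<alpha> (Suc t) *\<^sub>R zh (Suc t)"
    and z: "\<And>t. t < T \<Longrightarrow> z (Suc t) = z t - \<eta> (Suc t) *\<^sub>R (g (md t) + W (zh (Suc t)))"
    and md: "\<And>t. t < T \<Longrightarrow> md (Suc t) =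
               (1 - \<alpha> (Suc (Suc t))) *\<^sub>R ag (Suc t) + \<alpha> (Suc (Suc t)) *\<^sub>R z (Suc t)"
  shows "real T * (real T + 1) * bregman f g (ag T) w
    \<le> (2 * L + K * real T) * (norm (z 0 - w))\<^sup>2"
proof -
  define V where "V t = bregman f g (ag t) w" for t
  define D where "D t = (norm (z t - w))\<^sup>2" for t
  have V: "V t \<ge> 0" and D: "D t \<ge> 0" for t using lower by (simp_all add: V_def D_def)
  have pos: "2 * L + K * real t > 0" for t :: nat using L K by (simp add: add_pos_nonneg)
  \<comment> \<open>The recursion for \<open>md\<close> is given at positive indices only; at 0 both
    sides equal \<open>z 0\<close>, since the three sequences start at the same point.\<close>
  have md': "md t = (1 - \<alpha> (Suc t)) *\<^sub>R ag t + \<alpha> (Suc t) *\<^sub>R z t" if "t < T" for t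
    using that md init alpha[of 1] by (cases t) auto
  have step: "(real t + 1) * (real t + 2) * V (Suc t)
      \<le> real t * (real t + 1) * V t + (2 * L + K * (real t + 1)) * (D t - D (Suc t))"
    if "t < T" for t
  proof -
    define a where "a = \<alpha> (Suc t)"
    define e where "e = \<eta> (Suc t)"
    define N where "N = (norm (zh (Suc t) - z t))\<^sup>2"
    define Q where "Q = (g (md t) + W (zh (Suc t))) \<bullet> (zh (Suc t) - w)"
    have a: "a = 2 / (real t + 2)" using alpha[of "Suc t"] by (simp add: a_def)
    have e: "e = (real t + 1) / (2 * L + K * (real t + 1))"
      using eta[of "Suc t"] by (simp add: e_def add.commute)
    define P where "P = 2 * L + K * (real t + 1)"
    have P: "P > 0" using pos[of "Suc t"] by (simp add: P_def add.commute)
    have Pe: "P * e = real t + 1" using P by (simp add: e P_def)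
    have at: "(real t + 2) * a = 2" unfolding a by (simp add: field_simps)
    then have at': "(real t + 2) * (1 - a) = real t" by (simp add: algebra_simps)
    have a01: "0 \<le> a" "a \<le> 1" unfolding a by (simp_all add: field_simps)
    have e0: "e > 0" unfolding e using pos[of "Suc t"] by (simp add: add.commute)
    \<comment> \<open>Stationarity trades \<open>- g w\<close> for \<open>W w\<close>, and skewness
      trades \<open>W w\<close> for \<open>W (zh (Suc t))\<close>. So the inner product from the
      acceleration step is the one in the extragradient identity.\<close>
    have "g w = - W w" using zero by (simp add: eq_neg_iff_add_eq_0)
    then have "(g (md t) - g w) \<bullet> (zh (Suc t) - w) = Q"
      using skew[of "zh (Suc t)" w] by (simp add: Q_def inner_diff_left inner_add_left)
    then have agd: "V (Suc t) - (1 - a) * V t \<le> a * Q + L / 2 * (a\<^sup>2 * N)"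
      using accelerated_bregman_step[OF lower upper a01 md'[OF that, folded a_def] ag[OF that, folded a_def], of w]
      by (simp add: V_def N_def)
    have "(norm (W (zh (Suc t)) - W (z t)))\<^sup>2 \<le> K\<^sup>2 * N"
      using power_mono[OF lipschitz norm_ge_zero] by (simp add: N_def power_mult_distrib)
    then have "e\<^sup>2 * (norm (W (zh (Suc t)) - W (z t)))\<^sup>2 \<le> e\<^sup>2 * (K\<^sup>2 * N)"
      by (intro mult_left_mono) simp_all
    \<comment> \<open>What is left of \<open>- N\<close> after the Lipschitz error is at most
      \<open>- L * a * e * N\<close>, which is exactly what cancels the smoothness error in
      \<open>agd\<close>.\<close>
    moreover have "e\<^sup>2 * K\<^sup>2 + L * a * e \<le> 1"
      using step_size_bound[OF L K, of "Suc t"] by (simp add: a e add.commute)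
    then have "(e\<^sup>2 * K\<^sup>2 + L * a * e) * N \<le> 1 * N"
      by (intro mult_right_mono) (simp_all add: N_def)
    ultimately have "2 * e * Q \<le> D t - D (Suc t) - L * a * e * N"
      using extragradient_identity[OF zh[OF that, folded e_def] z[OF that, folded e_def], of w]
      by (simp add: Q_def D_def N_def algebra_simps)
    then have "2 * e * (Q + L / 2 * (a * N)) \<le> D t - D (Suc t)"
      by (simp add: algebra_simps)
    then have "a * (2 * e * (Q + L / 2 * (a * N))) \<le> a * (D t - D (Suc t))"
      using a01 by (intro mult_left_mono)
    moreover have "2 * e * (V (Suc t) - (1 - a) * V t) \<le> 2 * e * (a * Q + L / 2 * (a\<^sup>2 * N))"
      using agd e0 by (intro mult_left_mono) simp_all
    ultimately have "2 * e * (V (Suc t) - (1 - a) * V t) \<le> a * (D t - D (Suc t))"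
      by (simp add: algebra_simps power2_eq_square)
    \<comment> \<open>This multiplier clears all denominators: \<open>P * e\<close> becomes
      \<open>real t + 1\<close>, and \<open>real t + 2\<close> times \<open>a\<close> and
      \<open>1 - a\<close> becomes 2 and \<open>real t\<close>.\<close>
    then have "P * (real t + 2) / 2 * (2 * e * (V (Suc t) - (1 - a) * V t))
        \<le> P * (real t + 2) / 2 * (a * (D t - D (Suc t)))"
      using P by (intro mult_left_mono) simp_all
    also have "\<dots> = P * ((real t + 2) * a) / 2 * (D t - D (Suc t))" by (simp add: mult_ac)
    also have "\<dots> = P * (D t - D (Suc t))" unfolding at by simp
    finally have "(P * e) * ((real t + 2) * V (Suc t) - ((real t + 2) * (1 - a)) * V t)
        \<le> P * (D t - D (Suc t))"
      by (simp add: algebra_simps add_divide_distrib)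
    then have "(real t + 1) * ((real t + 2) * V (Suc t) - real t * V t) \<le> P * (D t - D (Suc t))"
      unfolding Pe at' .
    then show ?thesis by (simp add: P_def algebra_simps)
  qed
  \<comment> \<open>The term with \<open>D t\<close> stays on the left because the induction
    hypothesis serves twice: without its \<open>V\<close> term it yields
    \<open>D t \<le> D 0\<close>, and this pays for the increase by \<open>K\<close> of the weight
    in the next step.\<close>
  have "real t * (real t + 1) * V t + (2 * L + K * real t) * D t \<le> (2 * L + K * real t) * D 0"
    if "t \<le> T" for t
    using that
  proof (induction t)
    case 0
    then show ?case by simp
  next
    case (Suc t)
    then have IH: "real t * (real t + 1) * V t + (2 * L + K * real t) * D t
        \<le> (2 * L + K * real t) * D 0" by simp
    moreover have "0 \<le> real t * (real t + 1) * V t" using V by simp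
    ultimately have "(2 * L + K * real t) * D t \<le> (2 * L + K * real t) * D 0" by linarith
    then have "D t \<le> D 0" using pos[of t] by simp
    then have "K * D t \<le> K * D 0" using K by (rule mult_left_mono)
    with IH step[of t] Suc.prems show ?case
      by (simp add: algebra_simps)
  qed
  from this[of T] show ?thesis
    using mult_nonneg_nonneg[OF less_imp_le[OF pos[of T]] D[of T]] by (simp add: V_def D_def)
qed

section \<open>The largest eigenvalue and the operator norm of \<open>B\<close>\<close>

lemma inner_transpose_matrix_vector:
  fixes B :: "real ^ 'm ^ 'n"
  shows "u \<bullet> (transpose B *v v) = v \<bullet> (B *v u)"
  by (metis dot_lmul_matrix inner_commute transpose_matrix_vector)

text \<open>First-order optimality: \<open>l * (v \<bullet> v) - v \<bullet> (A *v v)\<close> is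
  nonnegative and vanishes at \<open>u\<close>. Moving from \<open>u\<close> against the residual
  \<open>q\<close> changes it by \<open>- 2 * s * (q \<bullet> q)\<close> to first order in
  \<open>s\<close>, which forces \<open>q = 0\<close>.\<close>

lemma quadratic_form_max_eigenvector:
  fixes A :: "real ^ 'k ^ 'k"
  assumes sym: "transpose A = A"
    and max: "\<And>v. v \<bullet> (A *v v) \<le> l * (v \<bullet> v)" and attained: "u \<bullet> (A *v u) = l * (u \<bullet> u)"
  shows "A *v u = l *\<^sub>R u"
proof -
  define q where "q = l *\<^sub>R u - A *v u"
  define C where "C = l * (q \<bullet> q) - q \<bullet> (A *v q)"
  have qu: "q \<bullet> (A *v u) = u \<bullet> (A *v q)"
    using inner_transpose_matrix_vector[of q A u] by (simp only: sym)
  have "0 \<le> s\<^sup>2 * C - 2 * s * (q \<bullet> q)" for s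
  proof -
    have "l * ((u - s *\<^sub>R q) \<bullet> (u - s *\<^sub>R q)) - (u - s *\<^sub>R q) \<bullet> (A *v (u - s *\<^sub>R q))
        = s\<^sup>2 * C - 2 * s * (l * (u \<bullet> q) - q \<bullet> (A *v u)) + (l * (u \<bullet> u) - u \<bullet> (A *v u))"
      using qu by (simp add: C_def matrix_vector_mult_diff_distrib matrix_vector_mult_scaleR inner_diff
          inner_commute[of q u] algebra_simps power2_eq_square)
    moreover have "l * (u \<bullet> q) - q \<bullet> (A *v u) = q \<bullet> q"
      by (simp add: q_def inner_diff inner_commute algebra_simps)
    ultimately show ?thesis using max[of "u - s *\<^sub>R q"] attained by simp
  qed
  note nonneg = this
  have "q \<bullet> q = 0"
  proof (rule ccontr)
    assume "q \<bullet> q \<noteq> 0"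
    then have N: "q \<bullet> q > 0" by simp
    \<comment> \<open>Small enough that the quadratic term \<open>s * s * C\<close> stays below half
      of the linear one; the added 1 covers \<open>C = 0\<close>.\<close>
    define s where "s = (q \<bullet> q) / (\<bar>C\<bar> + 1)"
    have s: "s > 0" using N by (simp add: s_def add_nonneg_pos)
    have "s * C \<le> s * (\<bar>C\<bar> + 1)" using s by (intro mult_left_mono) auto
    also have "\<dots> = q \<bullet> q" by (simp add: s_def)
    finally have "s * C - 2 * (q \<bullet> q) < 0" using N by linarith
    then have "s * (s * C - 2 * (q \<bullet> q)) < 0" using s by (intro mult_pos_neg)
    then show False using nonneg[of s] by (simp add: algebra_simps power2_eq_square)
  qed
  then show ?thesis by (simp add: q_def)
qed

text \<open>As \<open>lambda_max\<close> is defined by \<open>GREATEST\<close>, a greatest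
  eigenvalue must first be exhibited. The form attains its maximum on the compact unit sphere; this
  maximum is an eigenvalue, and testing the form on eigenvectors shows that no eigenvalue exceeds
  it.\<close>

lemma quadratic_form_le_lambda_max:
  fixes A :: "real ^ 'k ^ 'k"
  assumes sym: "transpose A = A"
  shows "v \<bullet> (A *v v) \<le> lambda_max A * (v \<bullet> v)"
proof -
  have "\<exists>u\<in>sphere (0 :: real ^ 'k) 1. \<forall>w\<in>sphere 0 1. w \<bullet> (A *v w) \<le> u \<bullet> (A *v u)"
    by (intro continuous_attains_sup continuous_intros
        linear_continuous_on[OF matrix_vector_mul_bounded_linear]) auto
  then obtain u :: "real ^ 'k" where u: "norm u = 1"
    and umax: "\<And>w. norm w = 1 \<Longrightarrow> w \<bullet> (A *v w) \<le> u \<bullet> (A *v u)"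
    by auto
  define l where "l = u \<bullet> (A *v u)"
  have uu: "u \<bullet> u = 1" using u by (simp add: norm_eq_1)
  have le: "w \<bullet> (A *v w) \<le> l * (w \<bullet> w)" for w
  proof (cases "w = 0")
    case False
    have "(1 / norm w) *\<^sub>R w \<bullet> (A *v ((1 / norm w) *\<^sub>R w)) \<le> l"
      unfolding l_def using False by (intro umax) simp
    then have "(w \<bullet> (A *v w)) / (norm w)\<^sup>2 \<le> l"
      by (simp add: matrix_vector_mult_scaleR power2_eq_square)
    then show ?thesis using False by (simp add: field_simps dot_square_norm)
  qed simp
  have "A *v u = l *\<^sub>R u"
    using quadratic_form_max_eigenvector[OF sym le, of u] uu by (simp add: l_def)
  moreover have "u \<noteq> 0" using u by auto
  ultimately have "matrix_eigenvalue A l" by (auto simp: matrix_eigenvalue_def)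
  moreover have "m \<le> l" if eig: "matrix_eigenvalue A m" for m
  proof -
    obtain w where w: "w \<noteq> 0" "A *v w = m *\<^sub>R w"
      using eig by (auto simp: matrix_eigenvalue_def)
    then have "m * (w \<bullet> w) \<le> l * (w \<bullet> w)" using le[of w] by simp
    then show ?thesis using w(1) by simp
  qed
  ultimately have "lambda_max A = l" unfolding lambda_max_def by (rule Greatest_equality)
  then show ?thesis using le by simp
qed

lemma norm_matrix_vector_le:
  fixes B :: "real ^ 'm ^ 'n"
  shows "(norm (B *v v))\<^sup>2 \<le> lambda_max (transpose B ** B) * (norm v)\<^sup>2"
proof -
  have "(norm (B *v v))\<^sup>2 = v \<bullet> ((transpose B ** B) *v v)"
    by (simp only: matrix_vector_mul_assoc[symmetric] inner_transpose_matrix_vector dot_square_norm)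
  also have "\<dots> \<le> lambda_max (transpose B ** B) * (v \<bullet> v)"
    by (intro quadratic_form_le_lambda_max) (simp add: matrix_transpose_mul)
  finally show ?thesis by (simp add: dot_square_norm)
qed

lemma lambda_max_gram_nonneg: "lambda_max (transpose B ** (B :: real ^ 'm ^ 'n)) \<ge> 0"
proof -
  obtain u :: "real ^ 'm" where u: "norm u = 1" using norm_axis_1 by blast
  have "0 \<le> (norm (B *v u))\<^sup>2" by simp
  also have "\<dots> \<le> lambda_max (transpose B ** B)" using norm_matrix_vector_le[of B u] u by simp
  finally show ?thesis .
qed

text \<open>No comparison of the spectra of the two Gram matrices is made. For
  \<open>w = transpose B *v v\<close>, Cauchy-Schwarz bounds the squared norm of \<open>w\<close> by
  \<open>norm v * norm (B *v w)\<close>; the bound for \<open>B\<close> applies to \<open>w\<close>,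
  and a factor cancels after squaring.\<close>

lemma norm_transpose_matrix_vector_le:
  fixes B :: "real ^ 'm ^ 'n"
  shows "(norm (transpose B *v v))\<^sup>2 \<le> lambda_max (transpose B ** B) * (norm v)\<^sup>2"
proof -
  define l where "l = lambda_max (transpose B ** B)"
  define w where "w = transpose B *v v"
  have l: "l \<ge> 0" unfolding l_def by (rule lambda_max_gram_nonneg)
  have "w \<bullet> w = v \<bullet> (B *v w)"
    unfolding w_def by (rule inner_transpose_matrix_vector)
  also have "\<dots> \<le> norm v * norm (B *v w)" by (rule norm_cauchy_schwarz)
  finally have "(norm w)\<^sup>2 \<le> norm v * norm (B *v w)" by (simp add: dot_square_norm)
  then have "((norm w)\<^sup>2)\<^sup>2 \<le> (norm v * norm (B *v w))\<^sup>2" by (intro power_mono) simp_all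
  also have "\<dots> \<le> (norm v)\<^sup>2 * (l * (norm w)\<^sup>2)"
    unfolding power_mult_distrib l_def by (intro mult_left_mono norm_matrix_vector_le) simp
  finally have le: "(norm w)\<^sup>2 * (norm w)\<^sup>2 \<le> (l * (norm v)\<^sup>2) * (norm w)\<^sup>2"
    by (simp add: power2_eq_square mult_ac)
  show ?thesis
  proof (cases "w = 0")
    case True
    then show ?thesis using l by (simp add: w_def l_def)
  next
    case False
    then have "(norm w)\<^sup>2 > 0" by simp
    with le have "(norm w)\<^sup>2 \<le> l * (norm v)\<^sup>2" by (rule mult_right_le_imp_le)
    then show ?thesis by (simp only: w_def l_def)
  qed
qed

section \<open>Gradients, stationarity and convexity constants\<close>

lemma grad_eqI:
  assumes "GDERIV f x :> D"
  shows "grad f x = D"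
  unfolding grad_def
proof (rule the_equality[of "\<lambda>D. GDERIV f x :> D", OF assms])
  fix D' assume "GDERIV f x :> D'"
  with assms have "(\<lambda>h. h \<bullet> D') = (\<lambda>h. h \<bullet> D)"
    unfolding gderiv_def by (rule has_derivative_unique[rotated])
  then have "h \<bullet> D' = h \<bullet> D" for h by meson
  then show "D' = D" using vector_eq_ldot by blast
qed

lemma grad_bilinear_coupling:
  "grad (\<lambda>u. bilinear_coupling B ux uy u v) u = B *v v - ux"
  "grad (bilinear_coupling B ux uy u) v = transpose B *v u + uy"
proof -
  show "grad (\<lambda>u. bilinear_coupling B ux uy u v) u = B *v v - ux"
    by (rule grad_eqI) (auto simp: gderiv_def bilinear_coupling_def inner_diff_right
        intro!: derivative_eq_intros)
  have "bilinear_coupling B ux uy u = (\<lambda>v. v \<bullet> (transpose B *v u + uy) - u \<bullet> ux)"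
    by (simp add: bilinear_coupling_def inner_add_right inner_transpose_matrix_vector
        inner_commute[of uy] fun_eq_iff del: transpose_matrix_vector)
  then show "grad (bilinear_coupling B ux uy u) v = transpose B *v u + uy"
    by (intro grad_eqI) (auto simp: gderiv_def intro!: derivative_eq_intros)
qed

text \<open>A gradient step of length \<open>1 / L\<close> from \<open>w\<close> would lower the
  objective by at least \<open>(d \<bullet> d) / (2 * L)\<close>, so \<open>d\<close> must vanish.
  The linear term \<open>c\<close> carries the bilinear coupling with the other player
  fixed.\<close>

lemma smooth_minimizer_stationary:
  fixes f :: "'a::real_inner \<Rightarrow> real"
  assumes upper: "\<And>z z'. bregman f g z z' \<le> L / 2 * (norm (z - z'))\<^sup>2" and L: "L > 0"
    and min: "\<And>z. f w + w \<bullet> c \<le> f z + z \<bullet> c"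
  shows "g w + c = 0"
proof -
  define d where "d = g w + c"
  define z where "z = w - (1 / L) *\<^sub>R d"
  have "bregman f g z w \<le> (d \<bullet> d) / (2 * L)"
    using upper[of z w] L by (simp add: z_def power_divide dot_square_norm power2_eq_square)
  moreover have "0 \<le> bregman f g z w + d \<bullet> (z - w)"
    using min[of z] by (simp add: bregman_def d_def inner_diff inner_add inner_commute)
  moreover have "d \<bullet> (z - w) = - (d \<bullet> d) / L" by (simp add: z_def)
  ultimately have "(d \<bullet> d) / L \<le> 0" using L by (simp add: field_simps)
  then have "d \<bullet> d \<le> 0" using L by (simp add: field_simps)
  then have "d = 0" by (metis inner_gt_zero_iff not_less)
  then show ?thesis by (simp add: d_def)
qed

lemma smooth_strongly_convexD:
  assumes "smooth_strongly_convex L \<mu> f"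
  shows "\<mu> / 2 * (norm (z - z'))\<^sup>2 \<le> bregman f (grad f) z z'"
    and "bregman f (grad f) z z' \<le> L / 2 * (norm (z - z'))\<^sup>2"
  using assms by (simp_all add: smooth_strongly_convex_def bregman_def)

text \<open>This makes \<open>L\<^sub>F\<close> and \<open>L\<^sub>G\<close> positive. A unit vector
  is available to compare the two bounds because index types are nonempty.\<close>

lemma smooth_strongly_convex_le:
  fixes f :: "real ^ 'k \<Rightarrow> real"
  assumes "smooth_strongly_convex L \<mu> f"
  shows "\<mu> \<le> L"
proof -
  obtain u :: "real ^ 'k" where "norm u = 1" using norm_axis_1 by blast
  then show ?thesis using smooth_strongly_convexD[OF assms, of u 0] by simp
qed

section \<open>Reduction of the saddle point problem to the joint variable\<close>

theorem theorem4p2: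
  fixes F :: "real ^ 'n \<Rightarrow> real" and G :: "real ^ 'm \<Rightarrow> real"
    and H :: "real ^ 'n \<Rightarrow> real ^ 'm \<Rightarrow> real"
    and B :: "real ^ 'm ^ 'n" and u\<^sub>x :: "real ^ 'n" and u\<^sub>y :: "real ^ 'm"
    and L\<^sub>F \<mu>\<^sub>F L\<^sub>G \<mu>\<^sub>G L_Str L_Bil \<mu>_Str R :: real
    and \<alpha> \<eta> :: "nat \<Rightarrow> real" and T :: nat
    and \<omega>\<^sub>x x0 :: "real ^ 'n" and \<omega>\<^sub>y y0 :: "real ^ 'm"
    and x xh xag xmd :: "nat \<Rightarrow> real ^ 'n" and y yh yag ymd :: "nat \<Rightarrow> real ^ 'm"
  assumes dims: "CARD('m) \<le> CARD('n)"
    and H: "H = bilinear_coupling B u\<^sub>x u\<^sub>y"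
    and mu_pos: "\<mu>\<^sub>F > 0" "\<mu>\<^sub>G > 0"
    and F: "smooth_strongly_convex L\<^sub>F \<mu>\<^sub>F F"
    and G: "smooth_strongly_convex L\<^sub>G \<mu>\<^sub>G G"
    and saddle: "saddle_point (\<lambda>u v. F u + H u v - G v) \<omega>\<^sub>x \<omega>\<^sub>y"
    and saddle_unique: "\<And>u' v'. saddle_point (\<lambda>u v. F u + H u v - G v) u' v'
                          \<Longrightarrow> u' = \<omega>\<^sub>x \<and> v' = \<omega>\<^sub>y"
    and L_Str: "L_Str = max L\<^sub>F (\<mu>\<^sub>F / \<mu>\<^sub>G * L\<^sub>G)"
    and L_Bil: "L_Bil = sqrt (lambda_max (transpose B ** B) * (\<mu>\<^sub>F / \<mu>\<^sub>G))"
    and mu_Str: "\<mu>_Str = \<mu>\<^sub>F"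
    and R: "R = \<mu>\<^sub>G / \<mu>\<^sub>F"
    and alpha: "\<And>t. t \<ge> 1 \<Longrightarrow> \<alpha> t = 2 / (real t + 1)"
    and eta: "\<And>t. t \<ge> 1 \<Longrightarrow> \<eta> t = real t / (2 * L_Str + L_Bil * real t)"
    and T: "T \<ge> 1"
    and run: "ag_eg_run F G H R \<alpha> \<eta> T x0 y0 x xh xag xmd y yh yag ymd"
  shows "(norm (xag T - \<omega>\<^sub>x))\<^sup>2 + R * (norm (yag T - \<omega>\<^sub>y))\<^sup>2
           \<le> 2 / (\<mu>_Str * (real T + 1)) * (2 * L_Str / real T + L_Bil)
              * ((norm (x0 - \<omega>\<^sub>x))\<^sup>2 + R * (norm (y0 - \<omega>\<^sub>y))\<^sup>2)"
proof -
  define l where "l = lambda_max (transpose B ** B)"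
  define r where "r = sqrt R"
  have R0: "R > 0" using R mu_pos by simp
  have r: "r > 0" "r * r = R" "R / r = r" using R0 by (simp_all add: r_def real_div_sqrt)
  have r2: "r\<^sup>2 = R" using r(2) by (simp add: power2_eq_square)
  have l: "l \<ge> 0" unfolding l_def by (rule lambda_max_gram_nonneg)
  have LF: "L\<^sub>F > 0" using smooth_strongly_convex_le[OF F] mu_pos by simp
  have LG: "L\<^sub>G > 0" using smooth_strongly_convex_le[OF G] mu_pos by simp
  \<comment> \<open>Scaling the second block by \<open>r\<close> divides the constants of
    \<open>G\<close> by \<open>R\<close>. The choice of \<open>R\<close> makes the two strong
    convexity constants equal, and \<open>L_Str\<close> dominates both smoothness constants.\<close>
  have L: "L_Str > 0" and LF_le: "L\<^sub>F \<le> L_Str" and "L\<^sub>G / R \<le> L_Str"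
    using LF by (auto simp: L_Str R mult.commute)
  then have LG_le: "L\<^sub>G \<le> L_Str * R" using R0 by (simp add: field_simps)
  have mu_G: "\<mu>\<^sub>G = \<mu>_Str * R" using mu_pos by (simp add: mu_Str R)
  have "L_Bil = sqrt (l / R)" by (simp add: L_Bil l_def R)
  then have K: "L_Bil \<ge> 0" and K2: "L_Bil\<^sup>2 = l / R" using l R0 by simp_all

  \<comment> \<open>The second component of \<open>p\<close> is the scaled variable. The inner
    factor \<open>1 / r\<close> undoes the scaling, and the outer one in \<open>g\<close> and
    \<open>W\<close> comes from the chain rule. \<open>W\<close> joins the x-gradient of the
    coupling with its negated y-gradient.\<close>
  define f where "f p = F (fst p) + G ((1 / r) *\<^sub>R snd p)" for p
  define g where "g p = (grad F (fst p), (1 / r) *\<^sub>R grad G ((1 / r) *\<^sub>R snd p))" for p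
  define W where "W p = (B *v ((1 / r) *\<^sub>R snd p) - u\<^sub>x,
      - (1 / r) *\<^sub>R (transpose B *v fst p + u\<^sub>y))" for p
  define w where "w = (\<omega>\<^sub>x, r *\<^sub>R \<omega>\<^sub>y)"
  define z where "z t = (x t, r *\<^sub>R y t)" for t
  define zh where "zh t = (xh t, r *\<^sub>R yh t)" for t
  define ag where "ag t = (xag t, r *\<^sub>R yag t)" for t
  define md where "md t = (xmd t, r *\<^sub>R ymd t)" for t

  have breg: "bregman f g p p' = bregman F (grad F) (fst p) (fst p')
      + bregman G (grad G) ((1 / r) *\<^sub>R snd p) ((1 / r) *\<^sub>R snd p')" for p p'
    by (simp add: bregman_def f_def g_def inner_prod_def inner_diff algebra_simps)
  have norm_snd: "(norm ((1 / r) *\<^sub>R snd p - (1 / r) *\<^sub>R snd p'))\<^sup>2 = (norm (snd (p - p')))\<^sup>2 / R"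
    for p p' :: "(real ^ 'n) \<times> (real ^ 'm)"
    using r by (simp add: scaleR_diff_right[symmetric] power_divide r2)
  have norm_prod: "(norm p)\<^sup>2 = (norm (fst p))\<^sup>2 + (norm (snd p))\<^sup>2"
    for p :: "(real ^ 'n) \<times> (real ^ 'm)"
    by (simp add: norm_prod_def)
  have strong: "\<mu>_Str / 2 * (norm (p - p'))\<^sup>2 \<le> bregman f g p p'" for p p'
    using smooth_strongly_convexD(1)[OF F, of "fst p" "fst p'"]
      smooth_strongly_convexD(1)[OF G, of "(1 / r) *\<^sub>R snd p" "(1 / r) *\<^sub>R snd p'"] R0
    unfolding breg norm_prod norm_snd mu_G by (simp add: mu_Str algebra_simps)
  have upper: "bregman f g p p' \<le> L_Str / 2 * (norm (p - p'))\<^sup>2" for p p'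
  proof -
    have "bregman F (grad F) (fst p) (fst p') \<le> L_Str / 2 * (norm (fst (p - p')))\<^sup>2"
      using smooth_strongly_convexD(2)[OF F, of "fst p" "fst p'"]
        mult_right_mono[OF LF_le, of "(norm (fst (p - p')))\<^sup>2"] by simp
    moreover have "bregman G (grad G) ((1 / r) *\<^sub>R snd p) ((1 / r) *\<^sub>R snd p')
        \<le> L_Str / 2 * (norm (snd (p - p')))\<^sup>2"
      using smooth_strongly_convexD(2)[OF G, of "(1 / r) *\<^sub>R snd p" "(1 / r) *\<^sub>R snd p'"]
        mult_right_mono[OF LG_le, of "(norm (snd (p - p')))\<^sup>2 / R"] R0
      unfolding norm_snd by simp
    ultimately show ?thesis unfolding breg norm_prod by (simp add: algebra_simps)
  qed
  have lower: "0 \<le> bregman f g p p'" for p p'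
    using strong[of p p'] mu_pos by (smt (verit) mu_Str mult_nonneg_nonneg half_gt_zero zero_le_power2)

  have W_diff: "W p - W p' = (B *v ((1 / r) *\<^sub>R snd (p - p')), - (1 / r) *\<^sub>R (transpose B *v fst (p - p')))"
    for p p'
    by (simp add: W_def matrix_vector_mult_diff_distrib algebra_simps)
  have skew: "(W p - W p') \<bullet> (p - p') = 0" for p p'
    unfolding W_diff inner_prod_def
    by (simp add: matrix_vector_mult_scaleR inner_transpose_matrix_vector inner_commute
        inner_transpose_matrix_vector[unfolded inner_commute[of _ "transpose B *v _"]]
        del: fst_diff snd_diff transpose_matrix_vector)
  have lipschitz: "norm (W p - W p') \<le> L_Bil * norm (p - p')" for p p'
  \<comment> \<open>\<open>W\<close> maps the second block into the first through \<open>B\<close>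
    and the first into the second through the transpose. Each contributes the factor
    \<open>l\<close> to the squared norm, and \<open>1 / r\<close> contributes
    \<open>1 / R\<close>.\<close>
  proof (rule power2_le_imp_le)
    have "(norm (W p - W p'))\<^sup>2
        = ((norm (B *v snd (p - p')))\<^sup>2 + (norm (transpose B *v fst (p - p')))\<^sup>2) / R"
      unfolding W_diff norm_prod
      using r by (simp add: matrix_vector_mult_scaleR power_divide r2 add_divide_distrib
          del: fst_diff snd_diff)
    also have "\<dots> \<le> (l * (norm (snd (p - p')))\<^sup>2 + l * (norm (fst (p - p')))\<^sup>2) / R"
      unfolding l_def using R0
      by (intro divide_right_mono add_mono norm_matrix_vector_le norm_transpose_matrix_vector_le) simp
    also have "\<dots> = (L_Bil * norm (p - p'))\<^sup>2"
      unfolding power_mult_distrib K2 norm_prod by (simp add: field_simps)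
    finally show "(norm (W p - W p'))\<^sup>2 \<le> (L_Bil * norm (p - p'))\<^sup>2" .
  qed (use K in simp)

  \<comment> \<open>Each half of the saddle inequality fixes one block and leaves a minimization of
    \<open>F\<close> or \<open>G\<close> plus a linear term; for \<open>G\<close> the maximization
    is negated.\<close>
  have Fw: "grad F \<omega>\<^sub>x + (B *v \<omega>\<^sub>y - u\<^sub>x) = 0"
  proof (rule smooth_minimizer_stationary[OF smooth_strongly_convexD(2)[OF F] LF])
    show "F \<omega>\<^sub>x + \<omega>\<^sub>x \<bullet> (B *v \<omega>\<^sub>y - u\<^sub>x) \<le> F u + u \<bullet> (B *v \<omega>\<^sub>y - u\<^sub>x)" for u
      using saddle by (simp add: saddle_point_def H bilinear_coupling_def inner_diff_right)
  qed
  have Gw: "grad G \<omega>\<^sub>y + - (transpose B *v \<omega>\<^sub>x + u\<^sub>y) = 0"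
  proof (rule smooth_minimizer_stationary[OF smooth_strongly_convexD(2)[OF G] LG])
    have "v \<bullet> (transpose B *v \<omega>\<^sub>x) = \<omega>\<^sub>x \<bullet> (B *v v)" for v
      by (rule inner_transpose_matrix_vector)
    then show "G \<omega>\<^sub>y + \<omega>\<^sub>y \<bullet> - (transpose B *v \<omega>\<^sub>x + u\<^sub>y) \<le> G v + v \<bullet> - (transpose B *v \<omega>\<^sub>x + u\<^sub>y)" for v
      using saddle by (simp add: saddle_point_def H bilinear_coupling_def inner_add_right
          inner_commute[of u\<^sub>y] algebra_simps)
  qed
  have zero: "g w + W w = 0"
  proof -
    have "grad G \<omega>\<^sub>y = transpose B *v \<omega>\<^sub>x + u\<^sub>y"
      using Gw by (metis add.inverse_inverse eq_neg_iff_add_eq_0)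
    then show ?thesis using Fw r(1) by (simp add: g_def W_def w_def zero_prod_def)
  qed

  \<comment> \<open>Matches the step sizes: the y-step \<open>e / R\<close>, scaled by
    \<open>r\<close>, is the common step \<open>e\<close> times the chain rule factor
    \<open>1 / r\<close>.\<close>
  have eta_r: "r * e / R = e / r" for e
    using r(1) by (simp add: r(2)[symmetric])
  have it: "xh t = x (t - 1) - \<eta> t *\<^sub>R (grad F (xmd (t - 1)) + (B *v y (t - 1) - u\<^sub>x))"
      "yh t = y (t - 1) - (\<eta> t / R) *\<^sub>R
        (- (transpose B *v x (t - 1) + u\<^sub>y) + grad G (ymd (t - 1)))"
      "xag t = (1 - \<alpha> t) *\<^sub>R xag (t - 1) + \<alpha> t *\<^sub>R xh t"
      "yag t = (1 - \<alpha> t) *\<^sub>R yag (t - 1) + \<alpha> t *\<^sub>R yh t"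
      "x t = x (t - 1) - \<eta> t *\<^sub>R (grad F (xmd (t - 1)) + (B *v yh t - u\<^sub>x))"
      "y t = y (t - 1) - (\<eta> t / R) *\<^sub>R (- (transpose B *v xh t + u\<^sub>y) + grad G (ymd (t - 1)))"
      "xmd t = (1 - \<alpha> (t + 1)) *\<^sub>R xag t + \<alpha> (t + 1) *\<^sub>R x t"
      "ymd t = (1 - \<alpha> (t + 1)) *\<^sub>R yag t + \<alpha> (t + 1) *\<^sub>R y t" if "t \<in> {1..T}" for t
    using run that unfolding ag_eg_run_def H grad_bilinear_coupling by blast+
  have init: "x 0 = x0" "xag 0 = x0" "xmd 0 = x0" "y 0 = y0" "yag 0 = y0" "ymd 0 = y0"
    using run by (simp_all add: ag_eg_run_def)
  have "real T * (real T + 1) * bregman f g (ag T) w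
      \<le> (2 * L_Str + L_Bil * real T) * (norm (z 0 - w))\<^sup>2"
  proof (rule accelerated_extragradient_bound[where \<alpha> = \<alpha> and \<eta> = \<eta> and W = W and zh = zh and md = md,
        OF L K lower upper skew lipschitz zero alpha eta])
    show "ag 0 = z 0" "md 0 = z 0" by (simp_all add: ag_def md_def z_def init)
    fix t assume "t < T"
    then have t: "Suc t \<in> {1..T}" by simp
    show "zh (Suc t) = z t - \<eta> (Suc t) *\<^sub>R (g (md t) + W (z t))"
      using r(1)
      by (simp add: it(1,2)[OF t] zh_def z_def md_def g_def W_def algebra_simps eta_r)
    show "z (Suc t) = z t - \<eta> (Suc t) *\<^sub>R (g (md t) + W (zh (Suc t)))"
      using r(1)
      by (simp add: it(5,6)[OF t] zh_def z_def md_def g_def W_def algebra_simps eta_r)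
    show "ag (Suc t) = (1 - \<alpha> (Suc t)) *\<^sub>R ag t + \<alpha> (Suc t) *\<^sub>R zh (Suc t)"
      using it(3,4)[OF t] by (simp add: zh_def ag_def scaleR_add_right mult.commute)
    show "md (Suc t) = (1 - \<alpha> (Suc (Suc t))) *\<^sub>R ag (Suc t) + \<alpha> (Suc (Suc t)) *\<^sub>R z (Suc t)"
      using it(7,8)[OF t] by (simp add: z_def ag_def md_def scaleR_add_right mult.commute)
  qed

  \<comment> \<open>From the divergence bound back to distances in the original variables\<close>
  moreover have "real T * (real T + 1) * (\<mu>_Str / 2 * (norm (ag T - w))\<^sup>2)
      \<le> real T * (real T + 1) * bregman f g (ag T) w"
    by (intro mult_left_mono strong) simp
  ultimately have main: "real T * (real T + 1) * (\<mu>_Str / 2 * (norm (ag T - w))\<^sup>2)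
      \<le> (2 * L_Str + L_Bil * real T) * (norm (z 0 - w))\<^sup>2"
    by linarith
  have scaled: "(norm ((u, r *\<^sub>R v) - w))\<^sup>2 = (norm (u - \<omega>\<^sub>x))\<^sup>2 + R * (norm (v - \<omega>\<^sub>y))\<^sup>2" for u v
    unfolding norm_prod w_def
    by (simp add: scaleR_diff_right[symmetric] power_mult_distrib r2)
  define Q where "Q = real T * (real T + 1) * \<mu>_Str / 2"
  have Q: "Q > 0" using T mu_pos by (simp add: Q_def mu_Str)
  have "Q * (norm (ag T - w))\<^sup>2 \<le> (2 * L_Str + L_Bil * real T) * (norm (z 0 - w))\<^sup>2"
    using main by (simp add: Q_def)
  then have "(norm (ag T - w))\<^sup>2 \<le> (2 * L_Str + L_Bil * real T) * (norm (z 0 - w))\<^sup>2 / Q"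
    using Q by (simp add: field_simps)
  also have "\<dots> = 2 / (\<mu>_Str * (real T + 1)) * (2 * L_Str / real T + L_Bil) * (norm (z 0 - w))\<^sup>2"
    using T mu_pos by (simp add: Q_def mu_Str divide_simps)
  finally show ?thesis by (simp add: ag_def z_def scaled init)
qed

end
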